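(* Let $G$ be a $3$-uniform hypergraph, let $C=\{v_1,\dots,v_7\}$ be a $7$-element subset of $V(G)$, and let $D=V(G)\setminus C$. For $i=0,\dots,6$ let $\ell_i=\{v_{1+i},v_{2+i},v_{4+i}\}$ and $\mathcal{O}_i=\{v_{3+i},v_{5+i},v_{6+i}\}$, with indices read modulo $7$ in $\{1,\dots,7\}$, and let $F_1=\{\ell_i:i=0,\dots,6\}$, $F_2=\{\mathcal{O}_i:i=0,\dots,6\}$. Suppose that no edge $e\in E(G)$ satisfies $|e\cap C|=2$, and that: (i) the edge set of the subhypergraph $L$ of $G$ induced on $C$ is either empty or equal to $F_1$; (ii) for any two distinct vertices $u_2,u_3\in D$, $\Gamma_G(u_2,u_3)\cap C\in\{\emptyset,C\}\cup\{\ell_i\}_{i=0}^6\cup\{C\setminus\ell_i\}_{i=0}^6$. Construct a hypergraph $H$ on $V(G)$ from $G$ as follows: if $L$ has edge set $F_1$, replace these edges by $F_2$ (if $L$ has no edges, it is left empty); and for any $\{u_2,u_3\}\subseteq D$: 1. if $\Gamma_G(u_2,u_3)\cap C=\ell_i$, remove the edges $\{\{x,u_2,u_3\}:x\in\ell_i\}$ and add the edges $\{\{x,u_2,u_3\}:x\in\mathcal{O}_i\}$; 2. if $\Gamma_G(u_2,u_3)\cap C=C\setminus\ell_i$, remove the edges $\{\{x,u_2,u_3\}:x\in C\setminus\ell_i\}$ and add the edges $\{\{x,u_2,u_3\}:x\in C\setminus\mathcal{O}_i\}$. Then $G$ and $H$ are $E$-cospectral.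
   Context: A $3$-uniform hypergraph is a pair $(V,E)$ with $V$ finite and $E\subseteq\binom{V}{3}$; the subhypergraph induced on $C\subseteq V$ has edge set $\{e\in E:e\subseteq C\}$. $\Gamma_G(u_2,u_3)=\{x\in V(G):\{x,u_2,u_3\}\in E(G)\}$. The adjacency tensor $\mathcal{A}_G$ is the order $3$, dimension $n=|V|$ tensor whose $(i_1,i_2,i_3)$ entry is $1$ if $\{i_1,i_2,i_3\}\in E$ and $0$ otherwise. For $x\in\mathbb{C}^n$, $(\mathcal{A}x)_i=\sum_{i_2,i_3\in[n]}a_{i\,i_2i_3}x_{i_2}x_{i_3}$. A number $\lambda\in\mathbb{C}$ is a normalized $E$-eigenvalue of $\mathcal{A}$ if there is $x\in\mathbb{C}^n$ with $\mathcal{A}x=\lambda x$ and $x^\top x=1$. Two $3$-uniform hypergraphs are $E$-cospectral if their adjacency tensors have the same set of normalized $E$-eigenvalues. *)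

theory Defs
  imports Complex_Main
begin

section \<open>3-uniform hypergraphs\<close>

type_synonym 'a hypergraph = "'a set \<times> 'a set set"

definition verts :: "'a hypergraph \<Rightarrow> 'a set" where
  "verts G = fst G"

definition edges :: "'a hypergraph \<Rightarrow> 'a set set" where
  "edges G = snd G"

definition uniform3_hypergraph :: "'a hypergraph \<Rightarrow> bool" where
  "uniform3_hypergraph G \<longleftrightarrow>
     finite (verts G) \<and> edges G \<subseteq> {e. e \<subseteq> verts G \<and> card e = 3}"

definition induced_subhypergraph :: "'a hypergraph \<Rightarrow> 'a set \<Rightarrow> 'a hypergraph" where
  "induced_subhypergraph G C = (C, {e \<in> edges G. e \<subseteq> C})"

definition link :: "'a hypergraph \<Rightarrow> 'a \<Rightarrow> 'a \<Rightarrow> 'a set" where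
  "link G u2 u3 = {x \<in> verts G. {x, u2, u3} \<in> edges G}"

section \<open>Normalized E-eigenvalues\<close>

text \<open>
  A tensor of order 3 and dimension \<open>n\<close> is indexed by an \<open>n\<close>-element set \<open>I\<close> rather than by
  \<open>{1..n}\<close>, so that no enumeration of the vertices has to be chosen. Vectors are
  functions of which only the values on \<open>I\<close> are used.
\<close>

definition adjacency_tensor :: "'a hypergraph \<Rightarrow> 'a \<Rightarrow> 'a \<Rightarrow> 'a \<Rightarrow> complex" where
  "adjacency_tensor G i1 i2 i3 = (if {i1, i2, i3} \<in> edges G then 1 else 0)"

definition tensor_apply ::
    "'a set \<Rightarrow> ('a \<Rightarrow> 'a \<Rightarrow> 'a \<Rightarrow> complex) \<Rightarrow> ('a \<Rightarrow> complex) \<Rightarrow> 'a \<Rightarrow> complex" where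
  "tensor_apply I A x i = (\<Sum>i2\<in>I. \<Sum>i3\<in>I. A i i2 i3 * x i2 * x i3)"

text \<open>The normalization is the bilinear \<open>x\<^sup>T x = 1\<close>, without complex conjugation.\<close>

definition normalized_E_eigenvalue ::
    "'a set \<Rightarrow> ('a \<Rightarrow> 'a \<Rightarrow> 'a \<Rightarrow> complex) \<Rightarrow> complex \<Rightarrow> bool" where
  "normalized_E_eigenvalue I A c \<longleftrightarrow>
     (\<exists>x :: 'a \<Rightarrow> complex.
        (\<forall>i\<in>I. tensor_apply I A x i = c * x i) \<and> (\<Sum>i\<in>I. x i * x i) = 1)"

definition E_cospectral :: "'a hypergraph \<Rightarrow> 'b hypergraph \<Rightarrow> bool" where
  "E_cospectral G H \<longleftrightarrow>
     {c. normalized_E_eigenvalue (verts G) (adjacency_tensor G) c} =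
     {c. normalized_E_eigenvalue (verts H) (adjacency_tensor H) c}"

section \<open>Fano switching\<close>

text \<open>Subscripts modulo 7 with representatives \<open>1, \<dots>, 7\<close>.\<close>

definition idx7 :: "nat \<Rightarrow> nat" where
  "idx7 k = (if k mod 7 = 0 then 7 else k mod 7)"

definition fano_line :: "(nat \<Rightarrow> 'a) \<Rightarrow> nat \<Rightarrow> 'a set" where
  "fano_line v i = {v (idx7 (1 + i)), v (idx7 (2 + i)), v (idx7 (4 + i))}"

definition fano_oval :: "(nat \<Rightarrow> 'a) \<Rightarrow> nat \<Rightarrow> 'a set" where
  "fano_oval v i = {v (idx7 (3 + i)), v (idx7 (5 + i)), v (idx7 (6 + i))}"

definition F1 :: "(nat \<Rightarrow> 'a) \<Rightarrow> 'a set set" where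
  "F1 v = fano_line v ` {0..6}"

definition F2 :: "(nat \<Rightarrow> 'a) \<Rightarrow> 'a set set" where
  "F2 v = fano_oval v ` {0..6}"

text \<open>
  In both definitions the three parts are the edges inside \<open>C = {v 1, \<dots>, v 7}\<close>, those
  of case 1, and those of case 2. The same triple can be both removed and added in case 2,
  since \<open>C - fano_line v i\<close> and \<open>C - fano_oval v i\<close> share the vertex \<open>v (idx7 (7 + i))\<close>;
  such a triple is an edge of the switched hypergraph.
\<close>

definition removed_edges :: "'a hypergraph \<Rightarrow> (nat \<Rightarrow> 'a) \<Rightarrow> 'a set set" where
  "removed_edges G v =
     (let C = v ` {1..7}; D = verts G - C in
       (if edges (induced_subhypergraph G C) = F1 v then F1 v else {}) \<union>
       {{x, u2, u3} | x u2 u3 i. u2 \<in> D \<and> u3 \<in> D \<and> u2 \<noteq> u3 \<and> i \<in> {0..6} \<and>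
          link G u2 u3 \<inter> C = fano_line v i \<and> x \<in> fano_line v i} \<union>
       {{x, u2, u3} | x u2 u3 i. u2 \<in> D \<and> u3 \<in> D \<and> u2 \<noteq> u3 \<and> i \<in> {0..6} \<and>
          link G u2 u3 \<inter> C = C - fano_line v i \<and> x \<in> C - fano_line v i})"

definition added_edges :: "'a hypergraph \<Rightarrow> (nat \<Rightarrow> 'a) \<Rightarrow> 'a set set" where
  "added_edges G v =
     (let C = v ` {1..7}; D = verts G - C in
       (if edges (induced_subhypergraph G C) = F1 v then F2 v else {}) \<union>
       {{x, u2, u3} | x u2 u3 i. u2 \<in> D \<and> u3 \<in> D \<and> u2 \<noteq> u3 \<and> i \<in> {0..6} \<and>
          link G u2 u3 \<inter> C = fano_line v i \<and> x \<in> fano_oval v i} \<union>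
       {{x, u2, u3} | x u2 u3 i. u2 \<in> D \<and> u3 \<in> D \<and> u2 \<noteq> u3 \<and> i \<in> {0..6} \<and>
          link G u2 u3 \<inter> C = C - fano_line v i \<and> x \<in> C - fano_oval v i})"

definition fano_switch :: "'a hypergraph \<Rightarrow> (nat \<Rightarrow> 'a) \<Rightarrow> 'a hypergraph" where
  "fano_switch G v = (verts G, (edges G - removed_edges G v) \<union> added_edges G v)"

end

theory Submission
  imports Defs
begin

text \<open>
  There is a real orthogonal matrix \<open>Q\<close> of size 7 with constant row sum 1 that maps the indicator
  vector of each line of the Fano plane to that of the corresponding oval, and hence the indicators
  of complements likewise; it also transforms the adjacency tensor of the seven lines into that of
  the seven ovals. Extended by the identity on \<open>D\<close>, it gives an orthogonal \<open>R\<close> with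
  \<open>A\<^sub>H (R x) = R (A\<^sub>G x)\<close> for all \<open>x\<close>, because no edge meets \<open>C\<close> in exactly two vertices. An
  orthogonal matrix preserves \<open>x\<^sup>T x\<close>, so \<open>x \<mapsto> R x\<close> is a bijection between the normalized
  E-eigenvectors of \<open>G\<close> and \<open>H\<close> with equal eigenvalues.
\<close>

section \<open>The orthogonal matrix of order 7\<close>

text \<open>
  The only matrix sending each line to the oval of the same index, since the incidence matrix of the
  Fano plane is invertible.
\<close>
definition fano_matrix :: "nat \<Rightarrow> nat \<Rightarrow> complex" where
  "fano_matrix k j = (of_bool (j \<in> fano_oval id k) - of_bool (j = k)) / 2"

lemma atLeastAtMost_1_7: "{1..7} = {1, 2, 3, 4, 5, 6, 7::nat}"
  by auto

lemma atLeastAtMost_0_6: "{0..6} = {0, 1, 2, 3, 4, 5, 6::nat}"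
  by auto

lemma sum_1_7: "(\<Sum>k\<in>{1..7::nat}. f k) = f 1 + f 2 + f 3 + f 4 + f 5 + f 6 + (f 7 :: 'b::comm_monoid_add)"
  unfolding atLeastAtMost_1_7 by (simp add: add.assoc)

text \<open>Conceptual reason behind the case check, with indices modulo 7: \<open>k\<close> is not
  on oval \<open>k\<close>, so a row has squared norm (3 + 1)/4 = 1. Two distinct ovals
  \<open>i\<close>, \<open>j\<close> meet in one point. Since {3,5,6} are the non-squares and -1 is
  a non-square, exactly one of "\<open>i\<close> is on oval \<open>j\<close>" and "\<open>j\<close>
  is on oval \<open>i\<close>" holds; this contributes -1 and cancels the common point. Columns
  behave alike: twice column \<open>j\<close> is the indicator of line \<open>j\<close> minus that
  of \<open>j\<close>.\<close>

lemma fano_matrix_orthogonal: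
  assumes "i \<in> {1..7}" "j \<in> {1..7}"
  shows "(\<Sum>k\<in>{1..7}. fano_matrix k i * fano_matrix k j) = of_bool (i = j)"
    and "(\<Sum>k\<in>{1..7}. fano_matrix i k * fano_matrix j k) = of_bool (i = j)"
  using assms unfolding sum_1_7 unfolding atLeastAtMost_1_7
  by (elim insertE emptyE; simp add: fano_matrix_def fano_oval_def idx7_def)+

lemma fano_matrix_row_sum:
  "k \<in> {1..7} \<Longrightarrow> (\<Sum>j\<in>{1..7}. fano_matrix k j) = 1"
  unfolding sum_1_7 unfolding atLeastAtMost_1_7
  by (elim insertE emptyE; simp add: fano_matrix_def fano_oval_def idx7_def)

text \<open>Modulo 7, oval \<open>k\<close> meets line \<open>i\<close> in 0, 1 or 2 points
  according as \<open>k\<close> equals \<open>i\<close>, lies on line \<open>i\<close>, or lies on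
  oval \<open>i\<close>. The diagonal entry subtracts 1 exactly in the middle case, and halving
  leaves 0, 0, 1.\<close>

lemma fano_matrix_line:
  assumes "k \<in> {1..7}" "i \<in> {0..6}"
  shows "(\<Sum>j\<in>{1..7}. fano_matrix k j * of_bool (j \<in> fano_line id i)) = of_bool (k \<in> fano_oval id i)"
  using assms unfolding sum_1_7 unfolding atLeastAtMost_1_7 atLeastAtMost_0_6
  by (elim insertE emptyE; simp add: fano_matrix_def fano_oval_def fano_line_def idx7_def)

lemma F1_id: "F1 id = {{1,2,4},{2,3,5},{3,4,6},{4,5,7},{5,6,1},{6,7,2},{7,1,3}}"
  unfolding F1_def atLeastAtMost_0_6 by (simp add: fano_line_def idx7_def numeral_2_eq_2)

lemma F2_id: "F2 id = {{3,5,6},{4,6,7},{5,7,1},{6,1,2},{7,2,3},{1,3,4},{2,4,5}}"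
  unfolding F2_def atLeastAtMost_0_6 by (simp add: fano_oval_def idx7_def numeral_2_eq_2)

text \<open>For each \<open>i\<close> this is an identity between quadratic polynomials in
  \<open>x 1\<close>, ..., \<open>x 7\<close>, verified by expansion. It handles the edges inside
  \<open>C\<close> when they form \<open>F1\<close>.\<close>

lemma fano_matrix_tensor:
  assumes "i \<in> {1..7}"
  shows "tensor_apply {1..7} (\<lambda>a b c. of_bool ({a, b, c} \<in> F2 id)) (\<lambda>k. \<Sum>j\<in>{1..7}. fano_matrix k j * x j) i
    = (\<Sum>j\<in>{1..7}. fano_matrix i j * tensor_apply {1..7} (\<lambda>a b c. of_bool ({a, b, c} \<in> F1 id)) x j)"
  using assms unfolding tensor_apply_def sum_1_7 unfolding atLeastAtMost_1_7 F1_id F2_id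
  \<comment> \<open>\<open>set_eq_subset\<close> decides equality of explicit sets and so also
    discards index triples with a repetition.\<close>
  by (elim insertE emptyE; simp add: fano_matrix_def fano_oval_def idx7_def set_eq_subset; simp add: field_simps)

section \<open>Orthogonal changes of variables and E-eigenvalues\<close>

lemma tensor_apply_cong:
  "(\<And>a. a \<in> I \<Longrightarrow> x a = y a) \<Longrightarrow> (\<And>b c. b \<in> I \<Longrightarrow> c \<in> I \<Longrightarrow> A a b c = B a b c) \<Longrightarrow>
    tensor_apply I A x a = tensor_apply I B y a"
  by (simp add: tensor_apply_def)

lemma tensor_apply_scale: "tensor_apply I (\<lambda>a b c. s * A a b c) x a = s * tensor_apply I A x a"
  by (simp add: tensor_apply_def sum_distrib_left mult.assoc)

text \<open>The transpose of \<open>R\<close> is its inverse: \<open>col\<close> is the identity for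
  the transpose times \<open>R\<close>, \<open>row\<close> for \<open>R\<close> times the transpose.
  The intertwining \<open>AB\<close> carries eigenvectors of \<open>A\<close> to those of
  \<open>B\<close>; the converse pulls an eigenvector of \<open>B\<close> back by the
  transpose.\<close>

lemma normalized_E_eigenvalue_orthogonal:
  assumes I: "finite I"
    and col: "\<And>a b. a \<in> I \<Longrightarrow> b \<in> I \<Longrightarrow> (\<Sum>c\<in>I. R c a * R c b) = of_bool (a = b)"
    and row: "\<And>a b. a \<in> I \<Longrightarrow> b \<in> I \<Longrightarrow> (\<Sum>c\<in>I. R a c * R b c) = of_bool (a = b)"
    and AB: "\<And>x a. a \<in> I \<Longrightarrow>
      tensor_apply I B (\<lambda>a. \<Sum>b\<in>I. R a b * x b) a = (\<Sum>b\<in>I. R a b * tensor_apply I A x b)"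
  shows "normalized_E_eigenvalue I A = normalized_E_eigenvalue I B"
proof -
  have delta: "(\<Sum>b\<in>I. of_bool (a = b) * f b) = f a" if "a \<in> I" for a and f :: "'a \<Rightarrow> complex"
    using I that by (simp add: of_bool_def if_distrib[of "\<lambda>t. t * _"] cong: if_cong)
  have RtR: "(\<Sum>c\<in>I. R c a * (\<Sum>b\<in>I. R c b * f b)) = f a" if a: "a \<in> I" for a f
  proof -
    have "(\<Sum>c\<in>I. R c a * (\<Sum>b\<in>I. R c b * f b)) = (\<Sum>b\<in>I. (\<Sum>c\<in>I. R c a * R c b) * f b)"
      unfolding sum_distrib_left sum_distrib_right by (subst sum.swap) (simp add: mult.assoc)
    also have "\<dots> = f a"
      using delta[OF a] col[OF a] by simp
    finally show ?thesis .
  qed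
  have RRt: "(\<Sum>c\<in>I. R a c * (\<Sum>b\<in>I. R b c * f b)) = f a" if a: "a \<in> I" for a f
  proof -
    have "(\<Sum>c\<in>I. R a c * (\<Sum>b\<in>I. R b c * f b)) = (\<Sum>b\<in>I. (\<Sum>c\<in>I. R a c * R b c) * f b)"
      unfolding sum_distrib_left sum_distrib_right by (subst sum.swap) (simp add: mult.assoc)
    also have "\<dots> = f a"
      using delta[OF a] row[OF a] by simp
    finally show ?thesis .
  qed
  have isometry: "(\<Sum>a\<in>I. (\<Sum>b\<in>I. R a b * x b) * (\<Sum>b\<in>I. R a b * x b)) = (\<Sum>a\<in>I. x a * x a)" for x
  proof -
    have "(\<Sum>a\<in>I. (\<Sum>b\<in>I. R a b * x b) * (\<Sum>b\<in>I. R a b * x b))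
        = (\<Sum>a\<in>I. \<Sum>b\<in>I. x b * (R a b * (\<Sum>b\<in>I. R a b * x b)))"
      by (simp add: sum_distrib_right mult_ac)
    also have "\<dots> = (\<Sum>b\<in>I. x b * (\<Sum>a\<in>I. R a b * (\<Sum>b\<in>I. R a b * x b)))"
      by (subst sum.swap) (simp add: sum_distrib_left)
    finally show ?thesis
      by (simp add: RtR)
  qed
  show ?thesis
  proof (intro ext iffI)
    fix c
    assume "normalized_E_eigenvalue I A c"
    then obtain x where x: "\<And>a. a \<in> I \<Longrightarrow> tensor_apply I A x a = c * x a" "(\<Sum>a\<in>I. x a * x a) = 1"
      unfolding normalized_E_eigenvalue_def by blast
    have "tensor_apply I B (\<lambda>a. \<Sum>b\<in>I. R a b * x b) a = c * (\<Sum>b\<in>I. R a b * x b)" if "a \<in> I" for a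
      using AB[OF that, of x] x(1) by (simp add: sum_distrib_left mult_ac)
    then show "normalized_E_eigenvalue I B c"
      unfolding normalized_E_eigenvalue_def using isometry[of x] x(2) by fastforce
  next
    fix c
    assume "normalized_E_eigenvalue I B c"
    then obtain y where y: "\<And>a. a \<in> I \<Longrightarrow> tensor_apply I B y a = c * y a" "(\<Sum>a\<in>I. y a * y a) = 1"
      unfolding normalized_E_eigenvalue_def by blast
    \<comment> \<open>The transpose of \<open>R\<close> applied to \<open>y\<close>, so that
      \<open>R\<close> maps \<open>x\<close> to \<open>y\<close> on \<open>I\<close>. Then
      \<open>AB\<close> at \<open>x\<close> gives \<open>R\<close> applied to \<open>A x\<close>,
      and one more transpose cancels \<open>R\<close>.\<close>
    define x where "x b = (\<Sum>a\<in>I. R a b * y a)" for b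
    have Rx: "(\<Sum>b\<in>I. R a b * x b) = y a" if "a \<in> I" for a
      unfolding x_def using RRt[OF that] by simp
    have B: "(\<Sum>b\<in>I. R a b * tensor_apply I A x b) = c * y a" if "a \<in> I" for a
      using AB[OF that, of x] y(1)[OF that] that by (simp add: tensor_apply_def Rx)
    have "tensor_apply I A x a = c * x a" if a: "a \<in> I" for a
    proof -
      have "tensor_apply I A x a = (\<Sum>d\<in>I. R d a * (\<Sum>b\<in>I. R d b * tensor_apply I A x b))"
        using RtR[OF a] by simp
      also have "\<dots> = c * x a"
        by (simp add: B x_def sum_distrib_left mult_ac)
      finally show ?thesis .
    qed
    moreover have "(\<Sum>a\<in>I. x a * x a) = 1"
      using isometry[of x] y(2) by (simp add: Rx)
    ultimately show "normalized_E_eigenvalue I A c"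
      unfolding normalized_E_eigenvalue_def by blast
  qed
qed

section \<open>Lines and ovals on the index set, and switched pairs\<close>

lemma fano_line_subset: "fano_line id i \<subseteq> {1..7}" and fano_oval_subset: "fano_oval id i \<subseteq> {1..7}"
  by (auto simp: fano_line_def fano_oval_def idx7_def Suc_leI less_imp_le_nat)

text \<open>Moves questions about lines and ovals of vertices to the indices 1 to 7, where they are
  finite computations.\<close>

lemma fano_line_image: "fano_line v i = v ` fano_line id i"
  and fano_oval_image: "fano_oval v i = v ` fano_oval id i"
  by (simp_all add: fano_line_def fano_oval_def)

lemma F1_image: "F1 v = (`) v ` F1 id" and F2_image: "F2 v = (`) v ` F2 id"
  by (simp_all add: F1_def F2_def image_image fano_line_image[of v] fano_oval_image[of v])

text \<open>Makes the switching rule unambiguous: a link that is a line, or the complement of one,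
  determines the index of that line.\<close>

lemma fano_line_inject: "fano_line id i = fano_line id j \<longleftrightarrow> i = j" if "i \<in> {0..6}" "j \<in> {0..6}"
  using that unfolding atLeastAtMost_0_6
  by (elim insertE emptyE; simp add: fano_line_def idx7_def set_eq_subset)

lemma card_fano_line: "i \<in> {0..6} \<Longrightarrow> card (fano_line id i) = 3"
  unfolding atLeastAtMost_0_6 by (elim insertE emptyE; simp add: fano_line_def idx7_def)

text \<open>\<open>fano_pair S T\<close>: a link \<open>S\<close> on the seven points is switched to \<open>T\<close>.\<close>
definition fano_pair :: "nat set \<Rightarrow> nat set \<Rightarrow> bool" where
  "fano_pair S T \<longleftrightarrow> S = {} \<and> T = {} \<or> S = {1..7} \<and> T = {1..7} \<or>
     (\<exists>i\<in>{0..6}. S = fano_line id i \<and> T = fano_oval id i \<or>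
        S = {1..7} - fano_line id i \<and> T = {1..7} - fano_oval id i)"

text \<open>By linearity everything comes from \<open>fano_matrix_line\<close> and the row sum 1:
  the row sum settles the full set, and subtracting a line from it settles the complement.\<close>

lemma fano_matrix_pair:
  assumes "fano_pair S T" and k: "k \<in> {1..7}"
  shows "(\<Sum>j\<in>{1..7}. fano_matrix k j * of_bool (j \<in> S)) = of_bool (k \<in> T)"
proof -
  consider "S = {}" "T = {}" | "S = {1..7}" "T = {1..7}"
    | i where "i \<in> {0..6}" "S = fano_line id i" "T = fano_oval id i"
    | i where "i \<in> {0..6}" "S = {1..7} - fano_line id i" "T = {1..7} - fano_oval id i"
    using assms(1) unfolding fano_pair_def by blast
  then show ?thesis
  proof cases
    case 1
    then show ?thesis by simp
  next
    case 2
    then show ?thesis using fano_matrix_row_sum[OF k] k by simp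
  next
    case 3
    then show ?thesis using fano_matrix_line[OF k] by simp
  next
    case 4
    have "(\<Sum>j\<in>{1..7}. fano_matrix k j * of_bool (j \<in> S))
        = (\<Sum>j\<in>{1..7}. fano_matrix k j - fano_matrix k j * of_bool (j \<in> fano_line id i))"
      by (rule sum.cong) (auto simp: 4)
    also have "\<dots> = 1 - of_bool (k \<in> fano_oval id i)"
      using fano_matrix_row_sum[OF k] fano_matrix_line[OF k 4(1)] by (simp add: sum_subtractf)
    finally show ?thesis using k 4 by simp
  qed
qed

text \<open>If the matrix sends the indicator of \<open>S\<close> to that of \<open>T\<close>, its
  transpose sends \<open>T\<close> back to \<open>S\<close> by orthogonality. This is the form
  needed at a vertex of \<open>D\<close>, where the indicator of a link is paired with the
  transformed vector.\<close>

lemma fano_matrix_pair_transpose: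
  assumes "fano_pair S T"
  shows "(\<Sum>k\<in>{1..7}. of_bool (k \<in> T) * (\<Sum>j\<in>{1..7}. fano_matrix k j * x j)) = (\<Sum>j\<in>{1..7}. of_bool (j \<in> S) * x j)"
proof -
  have *: "(\<Sum>k\<in>{1..7}. fano_matrix k j * of_bool (k \<in> T)) = of_bool (j \<in> S)" if j: "j \<in> {1..7}" for j
  proof -
    have "(\<Sum>k\<in>{1..7}. fano_matrix k j * of_bool (k \<in> T))
       = (\<Sum>k\<in>{1..7}. fano_matrix k j * (\<Sum>i\<in>{1..7}. fano_matrix k i * of_bool (i \<in> S)))"
      by (intro sum.cong refl) (simp add: fano_matrix_pair[OF assms, symmetric])
    also have "\<dots> = (\<Sum>i\<in>{1..7}. (\<Sum>k\<in>{1..7}. fano_matrix k j * fano_matrix k i) * of_bool (i \<in> S))"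
      unfolding sum_distrib_left sum_distrib_right by (subst sum.swap) (simp add: mult.assoc)
    also have "\<dots> = (\<Sum>i\<in>{1..7}. of_bool (j = i) * of_bool (i \<in> S))"
      by (intro sum.cong refl) (simp only: fano_matrix_orthogonal(1)[OF j])
    also have "\<dots> = (\<Sum>i\<in>{1..7}. if j = i then of_bool (i \<in> S) else 0)"
      by (intro sum.cong) auto
    also have "\<dots> = of_bool (j \<in> S)"
      using j by (subst sum.delta') auto
    finally show ?thesis .
  qed
  have "(\<Sum>k\<in>{1..7}. of_bool (k \<in> T) * (\<Sum>j\<in>{1..7}. fano_matrix k j * x j))
      = (\<Sum>j\<in>{1..7}. (\<Sum>k\<in>{1..7}. fano_matrix k j * of_bool (k \<in> T)) * x j)"
    unfolding sum_distrib_left sum_distrib_right by (subst sum.swap) (simp add: mult_ac)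
  also have "\<dots> = (\<Sum>j\<in>{1..7}. of_bool (j \<in> S) * x j)"
    by (intro sum.cong refl) (simp only: *)
  finally show ?thesis .
qed


section \<open>Edges of the switched hypergraph by their position relative to
  \<open>C\<close>\<close>

locale fano_switching =
  fixes G :: "'a hypergraph" and v :: "nat \<Rightarrow> 'a" and C D :: "'a set"
  assumes G: "uniform3_hypergraph G"
    and inj: "inj_on v {1..7}"
    and C: "C = v ` {1..7}" "C \<subseteq> verts G"
    and D: "D = verts G - C"
    and no2: "\<forall>e\<in>edges G. card (e \<inter> C) \<noteq> 2"
    and i: "edges (induced_subhypergraph G C) = {} \<or> edges (induced_subhypergraph G C) = F1 v"
    and ii: "\<forall>u2\<in>D. \<forall>u3\<in>D. u2 \<noteq> u3 \<longrightarrow>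
       link G u2 u3 \<inter> C \<in>
         {{}, C} \<union> fano_line v ` {0..6} \<union> (\<lambda>j. C - fano_line v j) ` {0..6}"
begin

definition H :: "'a hypergraph" where
  "H = fano_switch G v"

definition switched :: bool where
  "switched \<longleftrightarrow> edges (induced_subhypergraph G C) = F1 v"

text \<open>The part of a link inside \<open>C\<close>, pulled back to indices. It also makes sense
  for \<open>b = c\<close>, because sums over pairs from \<open>D\<close> contain the
  diagonal.\<close>

definition trace :: "'a hypergraph \<Rightarrow> 'a \<Rightarrow> 'a \<Rightarrow> nat set" where
  "trace K b c = {k \<in> {1..7}. {v k, b, c} \<in> edges K}"

lemma fano_subset_C: "fano_line v j \<subseteq> C" "fano_oval v j \<subseteq> C"
  unfolding C(1) fano_line_image[of v] fano_oval_image[of v]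
  by (intro image_mono fano_line_subset fano_oval_subset)+

lemma F_subset_C: "e \<in> F1 v \<Longrightarrow> e \<subseteq> C" "e \<in> F2 v \<Longrightarrow> e \<subseteq> C"
  using fano_subset_C by (auto simp: F1_def F2_def)

lemma vC: "k \<in> {1..7} \<Longrightarrow> v k \<in> C"
  by (simp add: C)

lemma card_edge: "e \<in> edges G \<Longrightarrow> card e = 3"
  using G unfolding uniform3_hypergraph_def by auto

lemma removed_edges_eq:
  "removed_edges G v = {e \<in> F1 v. switched} \<union>
     {{x, b, c} | x b c i. b \<in> D \<and> c \<in> D \<and> b \<noteq> c \<and> i \<in> {0..6} \<and>
        link G b c \<inter> C = fano_line v i \<and> x \<in> fano_line v i} \<union>
     {{x, b, c} | x b c i. b \<in> D \<and> c \<in> D \<and> b \<noteq> c \<and> i \<in> {0..6} \<and>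
        link G b c \<inter> C = C - fano_line v i \<and> x \<in> C - fano_line v i}"
  unfolding removed_edges_def Let_def C(1)[symmetric] D[symmetric] switched_def by simp

lemma added_edges_eq:
  "added_edges G v = {e \<in> F2 v. switched} \<union>
     {{x, b, c} | x b c i. b \<in> D \<and> c \<in> D \<and> b \<noteq> c \<and> i \<in> {0..6} \<and>
        link G b c \<inter> C = fano_line v i \<and> x \<in> fano_oval v i} \<union>
     {{x, b, c} | x b c i. b \<in> D \<and> c \<in> D \<and> b \<noteq> c \<and> i \<in> {0..6} \<and>
        link G b c \<inter> C = C - fano_line v i \<and> x \<in> C - fano_oval v i}"
  unfolding added_edges_def Let_def C(1)[symmetric] D[symmetric] switched_def by simp

lemma edges_H: "edges H = edges G - removed_edges G v \<union> added_edges G v"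
  by (simp add: H_def fano_switch_def edges_def)

lemma verts_H: "verts H = verts G"
  by (simp add: H_def fano_switch_def verts_def)

text \<open>Switching touches only triples with three vertices or exactly one vertex in
  \<open>C\<close>; all other triples keep their status.\<close>

lemma changed_edge_cases:
  assumes "e \<in> removed_edges G v \<union> added_edges G v"
  obtains "e \<subseteq> C" | x b c where "e = {x, b, c}" "x \<in> C" "b \<in> D" "c \<in> D" "b \<noteq> c"
proof -
  have "e \<subseteq> C \<or> (\<exists>x b c. e = {x, b, c} \<and> x \<in> C \<and> b \<in> D \<and> c \<in> D \<and> b \<noteq> c)"
    using assms unfolding removed_edges_eq added_edges_eq
    by (elim UnE CollectE exE conjE)
      (use F_subset_C fano_subset_C[THEN subsetD] in \<open>blast\<close>)+
  then show ?thesis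
    using that by blast
qed

lemma edge_CCD:
  assumes "a \<in> C" "b \<in> C" "c \<in> D"
  shows "{a, b, c} \<notin> edges G" "{a, b, c} \<notin> edges H"
proof -
  show 1: "{a, b, c} \<notin> edges G"
  proof
    assume e: "{a, b, c} \<in> edges G"
    \<comment> \<open>The tensor is also evaluated at repeated indices; for \<open>a = b\<close> the
      set has too few elements to be an edge.\<close>
    have "a \<noteq> b"
      using card_edge[OF e] by (auto simp: card_insert_if split: if_splits)
    moreover have "{a, b, c} \<inter> C = {a, b}"
      using assms D by auto
    ultimately show False
      using no2 e by fastforce
  qed
  have "{a, b, c} \<notin> removed_edges G v \<union> added_edges G v"
  proof
    assume "{a, b, c} \<in> removed_edges G v \<union> added_edges G v"
    then show False
    proof (cases rule: changed_edge_cases)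
      case 1
      then show False using assms D by auto
    next
      case (2 x b' c')
      then have "b' \<in> {a, b, c}" "c' \<in> {a, b, c}"
        by blast+
      with 2 assms D have "b' = c" "c' = c"
        by auto
      with 2 show False by simp
    qed
  qed
  with 1 show "{a, b, c} \<notin> edges H"
    by (simp add: edges_H)
qed

lemma edge_DDD:
  assumes "a \<in> D" "b \<in> D" "c \<in> D"
  shows "{a, b, c} \<in> edges H \<longleftrightarrow> {a, b, c} \<in> edges G"
proof -
  have "{a, b, c} \<notin> removed_edges G v \<union> added_edges G v"
  proof
    assume "{a, b, c} \<in> removed_edges G v \<union> added_edges G v"
    then show False
      by (cases rule: changed_edge_cases) (use assms D in auto)
  qed
  then show ?thesis
    by (simp add: edges_H)
qed

text \<open>Triples from cases 1 and 2 contain a vertex of \<open>D\<close>, so inside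
  \<open>C\<close> only the replacement of \<open>F1\<close> by \<open>F2\<close> acts.\<close>

lemma edge_CCC:
  assumes "e \<subseteq> C"
  shows "e \<in> edges G \<longleftrightarrow> switched \<and> e \<in> F1 v" and "e \<in> edges H \<longleftrightarrow> switched \<and> e \<in> F2 v"
proof -
  have F1_ne: "F1 v \<noteq> {}"
    by (simp add: F1_def)
  have "e \<in> edges G \<longleftrightarrow> e \<in> edges (induced_subhypergraph G C)"
    using assms by (simp add: induced_subhypergraph_def edges_def)
  then show *: "e \<in> edges G \<longleftrightarrow> switched \<and> e \<in> F1 v"
    using i F1_ne unfolding switched_def by auto
  have "{x, b, c} \<noteq> e" if "b \<in> D" for x b c
    using that assms D by auto
  then have "e \<in> removed_edges G v \<longleftrightarrow> switched \<and> e \<in> F1 v"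
    and "e \<in> added_edges G v \<longleftrightarrow> switched \<and> e \<in> F2 v"
    unfolding removed_edges_eq added_edges_eq by auto
  with * show "e \<in> edges H \<longleftrightarrow> switched \<and> e \<in> F2 v"
    by (auto simp: edges_H)
qed

text \<open>Exactly one of the listed vertices lies in \<open>C\<close>, so the set recovers it and
  the unordered pair. As \<open>link\<close> is symmetric, the witnesses in
  \<open>removed_edges\<close> and \<open>added_edges\<close> can be replaced by given
  vertices.\<close>

lemma triple_eq_iff:
  assumes "x \<in> C" "x' \<in> C" "b \<in> D" "c \<in> D" "b' \<in> D" "c' \<in> D"
  shows "{x, b, c} = {x', b', c'} \<longleftrightarrow> x = x' \<and> (b = b' \<and> c = c' \<or> b = c' \<and> c = b')"
  using assms D by (auto simp: set_eq_iff)

lemma link_commute: "link G b c = link G c b"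
  by (simp add: link_def insert_commute)

lemma removed_CDD:
  assumes "x \<in> C" "b \<in> D" "c \<in> D" "b \<noteq> c"
  shows "{x, b, c} \<in> removed_edges G v \<longleftrightarrow>
     (\<exists>i\<in>{0..6}. link G b c \<inter> C = fano_line v i \<and> x \<in> fano_line v i \<or>
        link G b c \<inter> C = C - fano_line v i \<and> x \<in> C - fano_line v i)"
    (is "_ \<longleftrightarrow> ?R")
proof
  assume "{x, b, c} \<in> removed_edges G v"
  moreover have "{x, b, c} \<notin> F1 v"
    using F_subset_C(1) assms(2) D by blast
  ultimately obtain x' b' c' i where *: "{x, b, c} = {x', b', c'}" "b' \<in> D" "c' \<in> D" "i \<in> {0..6}"
    "link G b' c' \<inter> C = fano_line v i \<and> x' \<in> fano_line v i \<or>
       link G b' c' \<inter> C = C - fano_line v i \<and> x' \<in> C - fano_line v i"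
    unfolding removed_edges_eq by blast
  then have "x' \<in> C"
    by blast
  with * assms have "x = x'" "link G b c = link G b' c'"
    using triple_eq_iff[of x x' b c b' c'] link_commute by auto
  with * show ?R
    by auto
next
  assume ?R
  then show "{x, b, c} \<in> removed_edges G v"
    unfolding removed_edges_eq using assms by blast
qed

lemma added_CDD:
  assumes "x \<in> C" "b \<in> D" "c \<in> D" "b \<noteq> c"
  shows "{x, b, c} \<in> added_edges G v \<longleftrightarrow>
     (\<exists>i\<in>{0..6}. link G b c \<inter> C = fano_line v i \<and> x \<in> fano_oval v i \<or>
        link G b c \<inter> C = C - fano_line v i \<and> x \<in> C - fano_oval v i)"
    (is "_ \<longleftrightarrow> ?R")
proof
  assume "{x, b, c} \<in> added_edges G v"
  moreover have "{x, b, c} \<notin> F2 v"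
    using F_subset_C(2) assms(2) D by blast
  ultimately obtain x' b' c' i where *: "{x, b, c} = {x', b', c'}" "b' \<in> D" "c' \<in> D" "i \<in> {0..6}"
    "link G b' c' \<inter> C = fano_line v i \<and> x' \<in> fano_oval v i \<or>
       link G b' c' \<inter> C = C - fano_line v i \<and> x' \<in> C - fano_oval v i"
    unfolding added_edges_eq by blast
  \<comment> \<open>In the first case \<open>x'\<close> lies on an oval, which the equation for the
    link does not mention, so the ovals must be known to lie in \<open>C\<close>.\<close>
  then have "x' \<in> C"
    using fano_subset_C by blast
  with * assms have "x = x'" "link G b c = link G b' c'"
    using triple_eq_iff[of x x' b c b' c'] link_commute by auto
  with * show ?R
    by auto
next
  assume ?R
  then show "{x, b, c} \<in> added_edges G v"
    unfolding added_edges_eq using assms by blast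
qed

section \<open>Links read on the index set\<close>

lemma v_image_eq_iff: "S \<subseteq> {1..7} \<Longrightarrow> T \<subseteq> {1..7} \<Longrightarrow> v ` S = v ` T \<longleftrightarrow> S = T"
  using inj by (rule inj_on_image_eq_iff)

lemma v_mem_image_iff: "k \<in> {1..7} \<Longrightarrow> S \<subseteq> {1..7} \<Longrightarrow> v k \<in> v ` S \<longleftrightarrow> k \<in> S"
  using inj by (rule inj_on_image_mem_iff)

lemma link_eq_image_trace: "link G b c \<inter> C = v ` trace G b c"
  using C by (auto simp: link_def trace_def)

lemma C_minus_image: "S \<subseteq> {1..7} \<Longrightarrow> C - v ` S = v ` ({1..7} - S)"
  unfolding C(1) by (rule inj_on_image_set_diff[OF inj, symmetric]) auto

lemma link_eq_iff:
  "link G b c \<inter> C = fano_line v j \<longleftrightarrow> trace G b c = fano_line id j"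
  "link G b c \<inter> C = C - fano_line v j \<longleftrightarrow> trace G b c = {1..7} - fano_line id j"
proof -
  have "trace G b c \<subseteq> {1..7}"
    by (auto simp: trace_def)
  then show "link G b c \<inter> C = fano_line v j \<longleftrightarrow> trace G b c = fano_line id j"
    "link G b c \<inter> C = C - fano_line v j \<longleftrightarrow> trace G b c = {1..7} - fano_line id j"
    unfolding link_eq_image_trace fano_line_image[of v]
    using fano_line_subset[of j] by (simp_all add: C_minus_image v_image_eq_iff)
qed

text \<open>When the link in \<open>C\<close> is a line or a complement, all its triples are
  removed, so old triples survive only in the other cases. Added triples supply the rest, including
  those that were both removed and added.\<close>

lemma trace_H:
  assumes "b \<in> D" "c \<in> D" "b \<noteq> c"
  shows "trace H b c = {k \<in> {1..7}.
    k \<in> trace G b c \<and> \<not> (\<exists>i\<in>{0..6}. trace G b c = fano_line id i \<or> trace G b c = {1..7} - fano_line id i) \<or>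
    (\<exists>i\<in>{0..6}. trace G b c = fano_line id i \<and> k \<in> fano_oval id i \<or>
       trace G b c = {1..7} - fano_line id i \<and> k \<notin> fano_oval id i)}"
proof -
  have "{v k, b, c} \<in> edges H \<longleftrightarrow>
    k \<in> trace G b c \<and> \<not> (\<exists>i\<in>{0..6}. trace G b c = fano_line id i \<or> trace G b c = {1..7} - fano_line id i) \<or>
    (\<exists>i\<in>{0..6}. trace G b c = fano_line id i \<and> k \<in> fano_oval id i \<or>
       trace G b c = {1..7} - fano_line id i \<and> k \<notin> fano_oval id i)" if k: "k \<in> {1..7}" for k
  proof -
    have e: "{v k, b, c} \<in> edges G \<longleftrightarrow> k \<in> trace G b c"
      using k by (simp add: trace_def)
    have l: "v k \<in> fano_line v j \<longleftrightarrow> k \<in> fano_line id j" and o: "v k \<in> fano_oval v j \<longleftrightarrow> k \<in> fano_oval id j" for j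
      unfolding fano_line_image[of v] fano_oval_image[of v]
      using k fano_line_subset fano_oval_subset by (simp_all add: v_mem_image_iff)
    show ?thesis
      unfolding edges_H Un_iff Diff_iff e removed_CDD[OF vC[OF k] assms] added_CDD[OF vC[OF k] assms]
        link_eq_iff l o using vC[OF k] k by blast
  qed
  then show ?thesis
    unfolding trace_def[of H] by (intro Collect_cong conj_cong refl)
qed

text \<open>Hypothesis \<open>ii\<close> leaves four kinds of link, and each is switched as
  \<open>fano_pair\<close> prescribes. For \<open>b = c\<close> both traces are empty, since
  \<open>{x, c, c}\<close> is never an edge.\<close>

lemma fano_pair_trace:
  assumes "b \<in> D" "c \<in> D"
  shows "fano_pair (trace G b c) (trace H b c)"
proof (cases "b = c")
  case True
  have "{x, c, c} \<notin> edges G" for x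
    using card_edge[of "{x, c, c}"] by (auto simp: card_insert_if split: if_splits)
  moreover have "{x, c, c} \<notin> removed_edges G v \<union> added_edges G v" if "x \<in> C" for x
  proof
    assume "{x, c, c} \<in> removed_edges G v \<union> added_edges G v"
    then show False
    proof (cases rule: changed_edge_cases)
      case 1
      then show False using assms D by auto
    next
      case (2 x' b' c')
      then show False using triple_eq_iff[of x x' c c b' c'] that assms by auto
    qed
  qed
  ultimately show ?thesis
    using True vC by (auto simp: fano_pair_def trace_def edges_H)
next
  case False
  have sub: "trace G b c \<subseteq> {1..7}"
    by (auto simp: trace_def)
  \<comment> \<open>The sizes 0, 7, 3 and 4 keep the four kinds of link apart, so no second case of
    the switch can apply.\<close>
  have card_compl: "card ({1..7} - fano_line id j) = 4" if "j \<le> 6" for j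
    using card_fano_line[of j] card_Diff_subset[OF _ fano_line_subset, of j] that
    by (simp add: fano_line_def)
  have card_line: "card (fano_line id j) = 3" if "j \<le> 6" for j
    using card_fano_line[of j] that by simp
  have inject: "fano_line id i = fano_line id j \<longleftrightarrow> i = j" if "i \<le> 6" "j \<le> 6" for i j
    using fano_line_inject that by simp
  have line_neq_compl: "fano_line id i \<noteq> {1..7} - fano_line id j" if "i \<le> 6" "j \<le> 6" for i j
  proof
    assume eq: "fano_line id i = {1..7} - fano_line id j"
    show False
      using card_line[OF that(1)] unfolding eq card_compl[OF that(2)] by simp
  qed
  have compl_inject: "{1..7} - fano_line id i = {1..7} - fano_line id j \<longleftrightarrow> i = j" if "i \<le> 6" "j \<le> 6" for i j
    unfolding inject[OF that, symmetric] using fano_line_subset by (metis double_diff subset_refl)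
  consider "link G b c \<inter> C = {}" | "link G b c \<inter> C = C"
    | i where "i \<in> {0..6}" "link G b c \<inter> C = fano_line v i"
    | i where "i \<in> {0..6}" "link G b c \<inter> C = C - fano_line v i"
    using ii assms False by blast
  then show ?thesis
  proof cases
    case 1
    then have "trace G b c = {}"
      by (simp add: link_eq_image_trace)
    moreover from this have "trace G b c \<noteq> fano_line id j" "trace G b c \<noteq> {1..7} - fano_line id j" if "j \<le> 6" for j
      using card_line[OF that] card_compl[OF that] by (metis card.empty zero_neq_numeral)+
    then have "trace H b c = trace G b c"
      unfolding trace_H[OF assms False] using sub by auto
    ultimately show ?thesis
      by (simp add: fano_pair_def)
  next
    case 2
    then have "v ` trace G b c = v ` {1..7}"
      by (metis link_eq_image_trace C(1))
    then have "trace G b c = {1..7}"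
      using v_image_eq_iff[OF sub] by blast
    moreover from this have "trace G b c \<noteq> fano_line id j" "trace G b c \<noteq> {1..7} - fano_line id j" if "j \<le> 6" for j
      using card_line[OF that] card_compl[OF that] by (force simp del: card_Diff_subset)+
    then have "trace H b c = trace G b c"
      unfolding trace_H[OF assms False] using sub by auto
    ultimately show ?thesis
      by (simp add: fano_pair_def)
  next
    case 3
    then have "trace G b c = fano_line id i"
      by (simp add: link_eq_iff)
    moreover from this have "trace G b c = fano_line id j \<longleftrightarrow> j = i" "trace G b c \<noteq> {1..7} - fano_line id j" if "j \<le> 6" for j
      using inject[of i j] line_neq_compl[of i j] that 3(1) by (simp_all add: eq_commute[of i])
    then have "trace H b c = fano_oval id i"
      unfolding trace_H[OF assms False] using 3(1) fano_oval_subset[of i] by (simp cong: bex_cong_simp) auto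
    ultimately show ?thesis
      using 3(1) unfolding fano_pair_def by blast
  next
    case 4
    then have "trace G b c = {1..7} - fano_line id i"
      by (simp add: link_eq_iff)
    moreover from this have "trace G b c \<noteq> fano_line id j" "trace G b c = {1..7} - fano_line id j \<longleftrightarrow> j = i" if "j \<le> 6" for j
      using compl_inject[of i j] line_neq_compl[of j i] that 4(1) by (simp_all add: eq_commute)
    then have "trace H b c = {1..7} - fano_oval id i"
      unfolding trace_H[OF assms False] using 4(1) by (simp cong: bex_cong_simp) auto
    ultimately show ?thesis
      using 4(1) unfolding fano_pair_def by blast
  qed
qed

section \<open>The orthogonal matrix on all vertices\<close>

lemma v_inverse: "k \<in> {1..7} \<Longrightarrow> the_inv_into {1..7} v (v k) = k"
  using inj by (rule the_inv_into_f_f)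

text \<open>Outside the block on \<open>C\<close>, the Kronecker delta gives both the identity on
  \<open>D\<close> and the zero mixed blocks.\<close>

definition R :: "'a \<Rightarrow> 'a \<Rightarrow> complex" where
  "R a b = (if a \<in> C \<and> b \<in> C
     then fano_matrix (the_inv_into {1..7} v a) (the_inv_into {1..7} v b) else of_bool (a = b))"

lemma R_CC: "j \<in> {1..7} \<Longrightarrow> k \<in> {1..7} \<Longrightarrow> R (v j) (v k) = fano_matrix j k"
  by (simp only: R_def vC v_inverse simp_thms if_True)

lemma R_D: "b \<in> D \<Longrightarrow> R a b = of_bool (a = b)" "a \<in> D \<Longrightarrow> R a b = of_bool (a = b)"
  by (auto simp: R_def D)

lemma sum_verts: "(\<Sum>a\<in>verts G. f a) = (\<Sum>k\<in>{1..7}. f (v k)) + (\<Sum>a\<in>D. f a)" for f :: "'a \<Rightarrow> complex"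
proof -
  have "(\<Sum>a\<in>verts G. f a) = (\<Sum>a\<in>C. f a) + (\<Sum>a\<in>D. f a)"
    using G C(2) unfolding D uniform3_hypergraph_def by (subst add.commute) (simp add: sum.subset_diff)
  then show ?thesis
    unfolding C(1) by (simp only: sum.reindex[OF inj] comp_def)
qed

lemma verts_cases:
  assumes "a \<in> verts G"
  obtains k where "k \<in> {1..7}" "a = v k" | "a \<in> D"
  using assms C D by blast

lemma sum_R_C:
  assumes "k \<in> {1..7}"
  shows "(\<Sum>b\<in>verts G. R (v k) b * f b) = (\<Sum>j\<in>{1..7}. fano_matrix k j * f (v j))"
proof -
  have "R (v k) b = 0" if "b \<in> D" for b
    using that vC[OF assms] D by (auto simp: R_D)
  then show ?thesis
    unfolding sum_verts using assms by (simp add: R_CC del: atLeastAtMost_iff)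
qed

lemma sum_R_D:
  assumes "a \<in> D"
  shows "(\<Sum>b\<in>verts G. R a b * f b) = f a"
proof -
  have "(\<Sum>b\<in>verts G. R a b * f b) = (\<Sum>b\<in>verts G. if a = b then f b else 0)"
    using assms by (intro sum.cong) (auto simp: R_D)
  then show ?thesis
    using assms G D by (simp add: uniform3_hypergraph_def)
qed

lemma R_rows:
  assumes "a \<in> verts G" "b \<in> verts G"
  shows "(\<Sum>c\<in>verts G. R a c * R b c) = of_bool (a = b)"
  using assms(1)
proof (cases rule: verts_cases)
  case (1 k)
  show ?thesis
    using assms(2)
  proof (cases rule: verts_cases)
    case (1 j)
    have "(\<Sum>c\<in>verts G. R a c * R b c) = (\<Sum>i\<in>{1..7}. fano_matrix k i * fano_matrix j i)"
      unfolding \<open>a = v k\<close> sum_R_C[OF \<open>k \<in> {1..7}\<close>] using 1 by (simp add: R_CC del: atLeastAtMost_iff)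
    then show ?thesis
      using fano_matrix_orthogonal(2)[of k j] 1 \<open>a = v k\<close> \<open>k \<in> {1..7}\<close> inj_on_eq_iff[OF inj] by simp
  next
    case 2
    then have "a \<noteq> b"
      using 1 vC D by blast
    then show ?thesis
      using sum_R_D[OF 2, of "R a"] R_D(1)[OF 2] by (simp add: mult.commute)
  qed
next
  case 2
  then show ?thesis
    unfolding sum_R_D[OF 2] R_D(1)[OF 2] by auto
qed

lemma R_columns:
  assumes "a \<in> verts G" "b \<in> verts G"
  shows "(\<Sum>c\<in>verts G. R c a * R c b) = of_bool (a = b)"
proof (cases "a \<in> C \<and> b \<in> C")
  case True
  then obtain j k where jk: "j \<in> {1..7}" "k \<in> {1..7}" "a = v j" "b = v k"
    unfolding C(1) by blast
  moreover have "(\<Sum>c\<in>D. R c a * R c b) = 0"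
    using True D by (intro sum.neutral) (auto simp: R_D)
  ultimately have "(\<Sum>c\<in>verts G. R c a * R c b) = (\<Sum>i\<in>{1..7}. fano_matrix i j * fano_matrix i k)"
    unfolding sum_verts by (simp add: R_CC del: atLeastAtMost_iff)
  then show ?thesis
    using fano_matrix_orthogonal(1)[of j k] jk inj_on_eq_iff[OF inj] by simp
next
  case False
  then have "a \<in> D \<or> b \<in> D"
    using assms D by blast
  \<comment> \<open>A column indexed by a vertex of \<open>D\<close> is a unit vector, so at most
    one summand survives.\<close>
  then have "R c a * R c b = (if c = a then of_bool (a = b) else 0)" for c
    using R_D(1)[of a c] R_D(2)[of a b] R_D(1)[of b c] R_D(2)[of b a]
    by (cases "c = a"; cases "c = b") auto
  then show ?thesis
    using assms G by (simp add: uniform3_hypergraph_def)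
qed

section \<open>Blocks of the adjacency tensors and the intertwining relation\<close>

lemma adjacency_CCC:
  assumes "a \<in> {1..7}" "b \<in> {1..7}" "c \<in> {1..7}"
  shows "adjacency_tensor G (v a) (v b) (v c) = of_bool switched * of_bool ({a, b, c} \<in> F1 id)"
    and "adjacency_tensor H (v a) (v b) (v c) = of_bool switched * of_bool ({a, b, c} \<in> F2 id)"
proof -
  have "F1 id \<subseteq> Pow {1..7}" "F2 id \<subseteq> Pow {1..7}"
    using fano_line_subset fano_oval_subset unfolding F1_def F2_def by blast+
  moreover have "inj_on ((`) v) (Pow {1..7})"
    using inj by (rule inj_on_image_Pow)
  moreover have "{a, b, c} \<in> Pow {1..7}"
    using assms by blast
  ultimately have "v ` {a, b, c} \<in> F1 v \<longleftrightarrow> {a, b, c} \<in> F1 id" "v ` {a, b, c} \<in> F2 v \<longleftrightarrow> {a, b, c} \<in> F2 id"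
    unfolding F1_image[of v] F2_image[of v] by (metis inj_on_image_mem_iff)+
  moreover have "v ` {a, b, c} \<subseteq> C"
    using assms vC by blast
  ultimately show "adjacency_tensor G (v a) (v b) (v c) = of_bool switched * of_bool ({a, b, c} \<in> F1 id)"
    and "adjacency_tensor H (v a) (v b) (v c) = of_bool switched * of_bool ({a, b, c} \<in> F2 id)"
    using edge_CCC[of "v ` {a, b, c}"] by (auto simp: adjacency_tensor_def)
qed

lemma adjacency_CCD:
  assumes "a \<in> C" "b \<in> C" "c \<in> D" "K = G \<or> K = H"
  shows "adjacency_tensor K a b c = 0" "adjacency_tensor K a c b = 0" "adjacency_tensor K c a b = 0"
  using edge_CCD[OF assms(1-3)] assms(4) by (auto simp: adjacency_tensor_def insert_commute)

lemma adjacency_CDD: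
  assumes "k \<in> {1..7}"
  shows "adjacency_tensor K (v k) b c = of_bool (k \<in> trace K b c)"
    and "adjacency_tensor K b (v k) c = of_bool (k \<in> trace K b c)"
    and "adjacency_tensor K b c (v k) = of_bool (k \<in> trace K b c)"
  using assms by (auto simp: adjacency_tensor_def trace_def insert_commute)

lemma adjacency_DDD:
  "a \<in> D \<Longrightarrow> b \<in> D \<Longrightarrow> c \<in> D \<Longrightarrow> adjacency_tensor H a b c = adjacency_tensor G a b c"
  by (simp add: adjacency_tensor_def edge_DDD)

text \<open>Mixed terms, with one summation index in \<open>C\<close> and one in \<open>D\<close>,
  vanish because no edge has exactly two vertices in \<open>C\<close>.\<close>

lemma tensor_apply_C:
  assumes k: "k \<in> {1..7}" and K: "K = G \<or> K = H"
  shows "tensor_apply (verts G) (adjacency_tensor K) x (v k) =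
    tensor_apply {1..7} (\<lambda>a b c. adjacency_tensor K (v a) (v b) (v c)) (x \<circ> v) k +
    (\<Sum>b\<in>D. \<Sum>c\<in>D. of_bool (k \<in> trace K b c) * x b * x c)"
proof -
  have "adjacency_tensor K (v k) (v j) c = 0" "adjacency_tensor K (v k) c (v j) = 0"
    if "j \<in> {1..7}" "c \<in> D" for j c
    using adjacency_CCD[OF vC[OF k] vC[OF that(1)] that(2) K] by simp_all
  moreover have "adjacency_tensor K (v k) b c = of_bool (k \<in> trace K b c)" if "b \<in> D" for b c
    using k by (rule adjacency_CDD)
  ultimately show ?thesis
    unfolding tensor_apply_def sum_verts
    by (simp only: comp_def mult_zero_left sum.neutral_const add_0_left add_0_right cong: sum.cong)
qed

text \<open>Terms with both summation indices in \<open>C\<close> vanish for the same reason. The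
  two mixed sums agree by symmetry of the tensor, whence the factor 2.\<close>

lemma tensor_apply_D:
  assumes a: "a \<in> D" and K: "K = G \<or> K = H"
  shows "tensor_apply (verts G) (adjacency_tensor K) x a =
    2 * (\<Sum>b\<in>D. (\<Sum>k\<in>{1..7}. of_bool (k \<in> trace K a b) * x (v k)) * x b) +
    (\<Sum>b\<in>D. \<Sum>c\<in>D. adjacency_tensor K a b c * x b * x c)"
proof -
  have "adjacency_tensor K a (v j) (v k) = 0" if "j \<in> {1..7}" "k \<in> {1..7}" for j k
    using adjacency_CCD(3)[OF vC[OF that(1)] vC[OF that(2)] a K] .
  moreover have "adjacency_tensor K a (v j) b = of_bool (j \<in> trace K a b)"
    "adjacency_tensor K a b (v j) = of_bool (j \<in> trace K a b)"
    if "j \<in> {1..7}" "b \<in> D" for j b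
    using that(1) by (rule adjacency_CDD)+
  ultimately have "tensor_apply (verts G) (adjacency_tensor K) x a =
    (\<Sum>k\<in>{1..7}. \<Sum>b\<in>D. of_bool (k \<in> trace K a b) * x (v k) * x b) +
    ((\<Sum>b\<in>D. \<Sum>k\<in>{1..7}. of_bool (k \<in> trace K a b) * x (v k) * x b) +
    (\<Sum>b\<in>D. \<Sum>c\<in>D. adjacency_tensor K a b c * x b * x c))"
    unfolding tensor_apply_def sum_verts
    by (simp only: sum.distrib mult_zero_left sum.neutral_const add_0_left mult_ac cong: sum.cong)
  also have "(\<Sum>k\<in>{1..7}. \<Sum>b\<in>D. of_bool (k \<in> trace K a b) * x (v k) * x b) =
      (\<Sum>b\<in>D. \<Sum>k\<in>{1..7}. of_bool (k \<in> trace K a b) * x (v k) * x b)"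
    by (rule sum.swap)
  finally show ?thesis
    by (simp only: sum_distrib_right[symmetric] mult_2 add.assoc)
qed

text \<open>At a vertex of \<open>C\<close>, the inner block transforms by
  \<open>fano_matrix_tensor\<close> and the outer one by \<open>fano_matrix_pair\<close>. At a
  vertex of \<open>D\<close>, \<open>R\<close> acts as the identity and the mixed term is preserved
  by \<open>fano_matrix_pair_transpose\<close>.\<close>

lemma tensor_apply_R:
  assumes "a \<in> verts G"
  shows "tensor_apply (verts G) (adjacency_tensor H) (\<lambda>a. \<Sum>b\<in>verts G. R a b * x b) a =
    (\<Sum>b\<in>verts G. R a b * tensor_apply (verts G) (adjacency_tensor G) x b)"
  using assms
proof (cases rule: verts_cases)
  case (1 k)
  let ?y = "\<lambda>a. \<Sum>b\<in>verts G. R a b * x b"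
  let ?A1 = "\<lambda>a b c. of_bool ({a, b, c} \<in> F1 id)" and ?A2 = "\<lambda>a b c. of_bool ({a, b, c} \<in> F2 id)"
  have inner_G: "tensor_apply {1..7} (\<lambda>a b c. adjacency_tensor G (v a) (v b) (v c)) (x \<circ> v) j
      = of_bool switched * tensor_apply {1..7} ?A1 (x \<circ> v) j" if "j \<in> {1..7}" for j
    unfolding tensor_apply_scale[symmetric] by (rule tensor_apply_cong) (simp_all only: adjacency_CCC that)
  have "tensor_apply {1..7} (\<lambda>a b c. adjacency_tensor H (v a) (v b) (v c)) (?y \<circ> v) k
      = of_bool switched * tensor_apply {1..7} ?A2 (\<lambda>k. \<Sum>j\<in>{1..7}. fano_matrix k j * (x \<circ> v) j) k"
    unfolding tensor_apply_scale[symmetric]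
    by (rule tensor_apply_cong) (simp_all only: 1(1) adjacency_CCC sum_R_C comp_def)
  also have "\<dots> = (\<Sum>j\<in>{1..7}. fano_matrix k j * (of_bool switched * tensor_apply {1..7} ?A1 (x \<circ> v) j))"
    unfolding fano_matrix_tensor[OF 1(1)] by (simp only: sum_distrib_left mult_ac)
  finally have inner: "tensor_apply {1..7} (\<lambda>a b c. adjacency_tensor H (v a) (v b) (v c)) (?y \<circ> v) k
      = (\<Sum>j\<in>{1..7}. fano_matrix k j *
          tensor_apply {1..7} (\<lambda>a b c. adjacency_tensor G (v a) (v b) (v c)) (x \<circ> v) j)"
    by (simp only: inner_G cong: sum.cong)
  \<comment> \<open>On \<open>D\<close> the vectors \<open>?y\<close> and \<open>x\<close> agree, so
    only the indicator of the link changes.\<close>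
  have "(\<Sum>b\<in>D. \<Sum>c\<in>D. of_bool (k \<in> trace H b c) * ?y b * ?y c)
      = (\<Sum>b\<in>D. \<Sum>c\<in>D. (\<Sum>j\<in>{1..7}. fano_matrix k j * of_bool (j \<in> trace G b c)) * x b * x c)"
    by (intro sum.cong refl) (simp only: sum_R_D fano_matrix_pair[OF fano_pair_trace 1(1)])
  also have "\<dots> = (\<Sum>b\<in>D. \<Sum>j\<in>{1..7}. \<Sum>c\<in>D. fano_matrix k j * (of_bool (j \<in> trace G b c) * x b * x c))"
    unfolding sum_distrib_right by (intro sum.cong refl, subst sum.swap) (simp only: mult.assoc)
  also have "\<dots> = (\<Sum>j\<in>{1..7}. fano_matrix k j * (\<Sum>b\<in>D. \<Sum>c\<in>D. of_bool (j \<in> trace G b c) * x b * x c))"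
    unfolding sum_distrib_left by (rule sum.swap)
  finally have outer: "(\<Sum>b\<in>D. \<Sum>c\<in>D. of_bool (k \<in> trace H b c) * ?y b * ?y c)
      = (\<Sum>j\<in>{1..7}. fano_matrix k j * (\<Sum>b\<in>D. \<Sum>c\<in>D. of_bool (j \<in> trace G b c) * x b * x c))" .
  have "tensor_apply (verts G) (adjacency_tensor H) ?y a
      = (\<Sum>j\<in>{1..7}. fano_matrix k j * tensor_apply (verts G) (adjacency_tensor G) x (v j))"
    unfolding 1(2) tensor_apply_C[OF 1(1) disjI2[OF refl]] inner outer
    by (simp only: tensor_apply_C simp_thms sum.distrib distrib_left cong: sum.cong)
  then show ?thesis
    unfolding 1(2) sum_R_C[OF 1(1)] .
next
  case 2
  have "(\<Sum>k\<in>{1..7}. of_bool (k \<in> trace H a b) * (\<Sum>c\<in>verts G. R (v k) c * x c))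
      = (\<Sum>j\<in>{1..7}. of_bool (j \<in> trace G a b) * x (v j))" if "b \<in> D" for b
    using fano_matrix_pair_transpose[OF fano_pair_trace[OF 2 that], of "x \<circ> v"]
    by (simp only: sum_R_C comp_def cong: sum.cong)
  with 2 show ?thesis
    by (simp only: tensor_apply_D sum_R_D adjacency_DDD simp_thms cong: sum.cong)
qed

lemma E_cospectral_fano_switch: "E_cospectral G (fano_switch G v)"
proof -
  have "normalized_E_eigenvalue (verts G) (adjacency_tensor G) = normalized_E_eigenvalue (verts G) (adjacency_tensor H)"
    using G R_columns R_rows tensor_apply_R
    by (intro normalized_E_eigenvalue_orthogonal[where R = R]) (auto simp: uniform3_hypergraph_def)
  then show ?thesis
    unfolding E_cospectral_def H_def[symmetric] verts_H by simp
qed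

end

theorem corollary6p4:
  fixes G H :: "'a hypergraph" and v :: "nat \<Rightarrow> 'a" and C D :: "'a set"
  assumes G: "uniform3_hypergraph G"
    and inj: "inj_on v {1..7}"
    and C: "C = v ` {1..7}" "C \<subseteq> verts G"
    and D: "D = verts G - C"
    and no2: "\<forall>e\<in>edges G. card (e \<inter> C) \<noteq> 2"
    and i: "edges (induced_subhypergraph G C) = {} \<or> edges (induced_subhypergraph G C) = F1 v"
    and ii: "\<forall>u2\<in>D. \<forall>u3\<in>D. u2 \<noteq> u3 \<longrightarrow>
       link G u2 u3 \<inter> C \<in>
         {{}, C} \<union> fano_line v ` {0..6} \<union> (\<lambda>j. C - fano_line v j) ` {0..6}"
    and H: "H = fano_switch G v"
  shows "E_cospectral G H"
proof -
  interpret fano_switching G v C D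
    by unfold_locales (fact assms)+
  show ?thesis
    unfolding H by (rule E_cospectral_fano_switch)
qed

end
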